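(* Let $p\ge2$ and $\mathcal{B}\subset\Sigma_{2\times2}(p)$. Suppose that (i) $\mathbb{H}_2(\mathcal{B})$ is non-degenerated; (ii) there exists an $S$-invariant diagonal cycle $\overline{\beta}_q=\beta_1\beta_2\cdots\beta_q\beta_1$ of order $(m,q)$ (for some $q\ge1$, $m\ge2$) with invariant index set $\mathcal{K}\subseteq\{1,\dots,p^{m-1}\}$; and (iii) $\sum_{l\in\mathcal{K}}H^{(l)}_{m,n;\beta_1}$ is primitive for every $n$ with $2\le n\le q+1$. Then $\mathbb{H}_n(\mathcal{B})$ is primitive for all $n\ge2$.
   Context: Patterns. $\mathcal{S}_p=\{0,\dots,p-1\}$. $\mathbb{Z}_{m\times n}((i,j))=\{(i+n_1,j+n_2):0\le n_1\le m-1,0\le n_2\le n-1\}$, $\mathbb{Z}_{m\times n}=\mathbb{Z}_{m\times n}((0,0))$, $\Sigma_{m\times n}(p)=\mathcal{S}_p^{\mathbb{Z}_{m\times n}}$. Given $\mathcal{B}\subset\Sigma_{2\times2}(p)$, a pattern $U\in\mathcal{S}_p^R$, $R\subset\mathbb{Z}^2$, is $\mathcal{B}$-admissible if $U|_{\mathbb{Z}_{2\times2}((i,j))}\in\mathcal{B}$ (after translation) whenever $\mathbb{Z}_{2\times2}((i,j))\subset R$. Counting function: $\psi(u_1,\dots,u_n)=1+\sum_{k=1}^nu_kp^{n-k}$ for $u_k\in\mathcal{S}_p$. Transition matrices. For $n\ge2$, $\mathbb{H}_n=\mathbb{H}_n(\mathcal{B})$ is the $p^n\times p^n$ zero-one matrix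 whose $(i,j)$ entry is $1$ iff the pattern $(u_{s,t})_{0\le s\le1,0\le t\le n-1}$ on $\mathbb{Z}_{2\times n}$ with $i=\psi(u_{0,0},\dots,u_{0,n-1})$, $j=\psi(u_{1,0},\dots,u_{1,n-1})$ is $\mathcal{B}$-admissible. Write $\mathbb{H}_n$ as a $p\times p$ block matrix $[H_{n;i,j}]_{1\le i,j\le p}$ with blocks of size $p^{n-1}\times p^{n-1}$, and set $H_{n;\alpha}=H_{n;i,j}$ for $\alpha=\psi(i-1,j-1)\in\{1,\dots,p^2\}$. A matrix is non-compressible if it has no zero row and no zero column. $\mathbb{H}_2$ is non-degenerated if $H_{2;\alpha}$ is non-compressible for all $1\le\alpha\le p^2$. A non-negative square matrix $A$ is primitive if there is $N\ge1$ with all entries of $A^n$ positive for all $n\ge N$. Elementary patterns. For $m,n\ge2$, $1\le\alpha\le p^2$, $1\le k\le p^{m-1}$, $H^{(k)}_{m,n;\alpha}=H_{n;j_1,j_2}H_{n;j_2,j_3}\cdots H_{n;j_m,j_{m+1}}$, where $j_1,\dots,j_{m+1}\in\{1,\dots,p\}$ are determined by $\alpha=\psi(j_1-1,j_{m+1}-1)$ and $k=\psi(j_2-1,\dots,j_m-1)$. Connecting operator. For $m\ge2$ and $1\le\alpha,\beta\le p^2$, $S_{m;\alpha,\beta}$ is the $p^{m-1}\times p^{m-1}$ zero-one matrix whose $(s,t)$ entry is $1$ iff the pattern $(u_{a,b})_{0\le a\le m,0\le b\le1}$ on $\mathbb{Z}_{(m+1)\times2}$ with $\alpha=\psi(u_{0,0},u_{m,0})$,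 $\beta=\psi(u_{0,1},u_{m,1})$, $s=\psi(u_{1,0},\dots,u_{m-1,0})$, $t=\psi(u_{1,1},\dots,u_{m-1,1})$ is $\mathcal{B}$-admissible. Invariant diagonal cycles. $\mathcal{D}_p=\{1+j(p+1):j\in\mathcal{S}_p\}$. A diagonal cycle of length $q\ge1$ is a sequence $\overline{\beta}_q=\beta_1\beta_2\cdots\beta_q\beta_1$ with all $\beta_j\in\mathcal{D}_p$. It is an $S$-invariant diagonal cycle of order $(m,q)$ with invariant index set $\mathcal{K}\subseteq\{1,\dots,p^{m-1}\}$, $m\ge2$, if $\sum_{k\in\mathcal{K}}\left(S_{m;\beta_1,\beta_2}S_{m;\beta_2,\beta_3}\cdots S_{m;\beta_q,\beta_1}\right)_{k,l}\ge1$ for all $l\in\mathcal{K}$. *)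

theory Defs
  imports
    "HOL-Library.FuncSet"
    "Jordan_Normal_Form.Matrix"
begin

text \<open>The counting function and all indices of blocks, words and matrix entries are 1-based, as in
  the paper, whereas entries of the type of matrices are 0-based. The paper's entry \<open>A\<^sub>i\<^sub>j\<close>
  is therefore \<open>A $$ (i - 1, j - 1)\<close>.\<close>

definition rect_at :: "nat \<Rightarrow> nat \<Rightarrow> int \<times> int \<Rightarrow> (int \<times> int) set" where
  "rect_at m n c = {(fst c + int a, snd c + int b) | a b. a < m \<and> b < n}"

abbreviation rect :: "nat \<Rightarrow> nat \<Rightarrow> (int \<times> int) set" where
  "rect m n \<equiv> rect_at m n (0, 0)"

type_synonym pattern = "int \<times> int \<Rightarrow> nat"

definition patterns :: "nat \<Rightarrow> (int \<times> int) set \<Rightarrow> pattern set" where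
  "patterns p R = R \<rightarrow>\<^sub>E {..<p}"

definition window :: "pattern \<Rightarrow> int \<times> int \<Rightarrow> pattern" where
  "window U c = restrict (\<lambda>x. U (fst c + fst x, snd c + snd x)) (rect 2 2)"

definition admissible :: "pattern set \<Rightarrow> (int \<times> int) set \<Rightarrow> pattern \<Rightarrow> bool" where
  "admissible \<B> R U \<longleftrightarrow> (\<forall>c. rect_at 2 2 c \<subseteq> R \<longrightarrow> window U c \<in> \<B>)"

definition words :: "nat \<Rightarrow> nat \<Rightarrow> nat list set" where
  "words p n = {w. length w = n \<and> set w \<subseteq> {..<p}}"

text \<open>List positions start at 0, so the paper's \<open>u\<^sub>k\<close> is \<open>w ! (k - 1)\<close>.\<close>

definition psi :: "nat \<Rightarrow> nat list \<Rightarrow> nat" where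
  "psi p w = 1 + (\<Sum>k = 1..length w. w ! (k - 1) * p ^ (length w - k))"

text \<open>\<open>psi p\<close> is a bijection from \<open>words p n\<close> onto \<open>{1..p ^ n}\<close>; this is its inverse.\<close>

definition word_of :: "nat \<Rightarrow> nat \<Rightarrow> nat \<Rightarrow> nat list" where
  "word_of p n = inv_into (words p n) (psi p)"

text \<open>Matrices have entries in the natural numbers, so non-negativity is automatic for them.\<close>

definition H_mat :: "nat \<Rightarrow> pattern set \<Rightarrow> nat \<Rightarrow> nat mat" where
  "H_mat p \<B> n = mat (p ^ n) (p ^ n) (\<lambda>(i, j).
     if \<exists>U \<in> patterns p (rect 2 n). admissible \<B> (rect 2 n) U \<and>
          i + 1 = psi p (map (\<lambda>t. U (0, int t)) [0..<n]) \<and>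
          j + 1 = psi p (map (\<lambda>t. U (1, int t)) [0..<n])
     then 1 else 0)"

definition H_block :: "nat \<Rightarrow> pattern set \<Rightarrow> nat \<Rightarrow> nat \<Rightarrow> nat \<Rightarrow> nat mat" where
  "H_block p \<B> n i j = mat (p ^ (n - 1)) (p ^ (n - 1)) (\<lambda>(s, t).
     H_mat p \<B> n $$ ((i - 1) * p ^ (n - 1) + s, (j - 1) * p ^ (n - 1) + t))"

definition H_alpha :: "nat \<Rightarrow> pattern set \<Rightarrow> nat \<Rightarrow> nat \<Rightarrow> nat mat" where
  "H_alpha p \<B> n \<alpha> = (let w = word_of p 2 \<alpha> in H_block p \<B> n (w ! 0 + 1) (w ! 1 + 1))"

definition non_compressible :: "'a :: zero mat \<Rightarrow> bool" where
  "non_compressible A \<longleftrightarrow>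
     (\<forall>i < dim_row A. row A i \<noteq> 0\<^sub>v (dim_col A)) \<and>
     (\<forall>j < dim_col A. col A j \<noteq> 0\<^sub>v (dim_row A))"

definition H2_non_degenerated :: "nat \<Rightarrow> pattern set \<Rightarrow> bool" where
  "H2_non_degenerated p \<B> \<longleftrightarrow> (\<forall>\<alpha> \<in> {1..p\<^sup>2}. non_compressible (H_alpha p \<B> 2 \<alpha>))"

definition primitive_mat :: "'a :: linordered_semidom mat \<Rightarrow> bool" where
  "primitive_mat A \<longleftrightarrow> square_mat A \<and> (\<forall>a \<in> elements_mat A. 0 \<le> a) \<and>
     (\<exists>N \<ge> 1. \<forall>n \<ge> N. \<forall>i < dim_row A. \<forall>j < dim_col A. 0 < (A ^\<^sub>m n) $$ (i, j))"

text \<open>Products and sums of matrices of a common size \<open>d \<times> d\<close>.\<close>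

definition mat_prod_list :: "nat \<Rightarrow> 'a :: semiring_1 mat list \<Rightarrow> 'a mat" where
  "mat_prod_list d As = foldr (*) As (1\<^sub>m d)"

definition mat_sum :: "nat \<Rightarrow> ('b \<Rightarrow> 'a :: comm_monoid_add mat) \<Rightarrow> 'b set \<Rightarrow> 'a mat" where
  "mat_sum d F I = mat d d (\<lambda>ij. \<Sum>x \<in> I. F x $$ ij)"

text \<open>The list \<open>js\<close> holds \<open>j\<^sub>1 - 1, \<dots>, j\<^sub>m\<^sub>+\<^sub>1 - 1\<close>.\<close>

definition H_elem :: "nat \<Rightarrow> pattern set \<Rightarrow> nat \<Rightarrow> nat \<Rightarrow> nat \<Rightarrow> nat \<Rightarrow> nat mat" where
  "H_elem p \<B> m n \<alpha> k =
     (let e = word_of p 2 \<alpha>; js = [e ! 0] @ word_of p (m - 1) k @ [e ! 1]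
      in mat_prod_list (p ^ (n - 1))
           (map (\<lambda>c. H_block p \<B> n (js ! c + 1) (js ! (c + 1) + 1)) [0..<m]))"

definition S_mat :: "nat \<Rightarrow> pattern set \<Rightarrow> nat \<Rightarrow> nat \<Rightarrow> nat \<Rightarrow> nat mat" where
  "S_mat p \<B> m \<alpha> \<beta> = mat (p ^ (m - 1)) (p ^ (m - 1)) (\<lambda>(s, t).
     if \<exists>U \<in> patterns p (rect (m + 1) 2). admissible \<B> (rect (m + 1) 2) U \<and>
          \<alpha> = psi p [U (0, 0), U (int m, 0)] \<and>
          \<beta> = psi p [U (0, 1), U (int m, 1)] \<and>
          s + 1 = psi p (map (\<lambda>a. U (int a, 0)) [1..<m]) \<and>
          t + 1 = psi p (map (\<lambda>a. U (int a, 1)) [1..<m])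
     then 1 else 0)"

definition diag_indices :: "nat \<Rightarrow> nat set" where
  "diag_indices p = {1 + j * (p + 1) | j. j < p}"

text \<open>A diagonal cycle \<open>\<beta>\<^sub>1 \<beta>\<^sub>2 \<dots> \<beta>\<^sub>q \<beta>\<^sub>1\<close> is given by the list of
  \<open>\<beta>\<^sub>1, \<dots>, \<beta>\<^sub>q\<close>, without the repeated last element.\<close>

definition diagonal_cycle :: "nat \<Rightarrow> nat \<Rightarrow> nat list \<Rightarrow> bool" where
  "diagonal_cycle p q \<beta>s \<longleftrightarrow> q \<ge> 1 \<and> length \<beta>s = q \<and> set \<beta>s \<subseteq> diag_indices p"

definition S_cycle_prod :: "nat \<Rightarrow> pattern set \<Rightarrow> nat \<Rightarrow> nat list \<Rightarrow> nat mat" where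
  "S_cycle_prod p \<B> m \<beta>s = mat_prod_list (p ^ (m - 1))
     (map (\<lambda>c. S_mat p \<B> m (\<beta>s ! c) (\<beta>s ! ((c + 1) mod length \<beta>s))) [0..<length \<beta>s])"

definition S_invariant_diagonal_cycle ::
    "nat \<Rightarrow> pattern set \<Rightarrow> nat \<Rightarrow> nat \<Rightarrow> nat list \<Rightarrow> nat set \<Rightarrow> bool" where
  "S_invariant_diagonal_cycle p \<B> m q \<beta>s K \<longleftrightarrow>
     m \<ge> 2 \<and> diagonal_cycle p q \<beta>s \<and> K \<subseteq> {1..p ^ (m - 1)} \<and>
     (\<forall>l \<in> K. (\<Sum>k \<in> K. S_cycle_prod p \<B> m \<beta>s $$ (k - 1, l - 1)) \<ge> 1)"

end

theory Submission
  imports Defs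
begin

text \<open>Stacking rows along the cycle shows that, on words of length \<open>n - 1 + q\<close> with the prefix
  \<open>\<beta>\<^sub>2 \<dots> \<beta>\<^sub>q \<beta>\<^sub>1\<close> (each diagonal index read as its letter), the support of
  \<open>A\<^sub>n\<^sub>+\<^sub>q = \<Sum>l\<in>K. H_elem m (n + q) \<beta>\<^sub>1 l\<close> contains a copy of the support of \<open>A\<^sub>n\<close>. Since
  \<open>H\<^sub>2\<close> is non-degenerated, every partial filling of a strip can be completed upwards
  from a prescribed left or right column; so primitivity of \<open>A\<^sub>q\<^sub>+\<^sub>1\<close> leads from every word to
  that prefix and back, and all \<open>A\<^sub>n\<close> are primitive. Within the words starting with the
  letter of \<open>\<beta>\<^sub>1\<close>, \<open>H\<^sub>n\<^sup>m\<close> dominates \<open>A\<^sub>n\<close>, and non-degeneracy enters this set in any positive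
  number of steps and leaves it in one, which makes \<open>H\<^sub>n\<close> primitive.\<close>

section \<open>Adjacency of words and fillings of strips\<close>

text \<open>The square has bottom row \<open>a b\<close> and top row \<open>c d\<close>.\<close>

definition allowed :: "pattern set \<Rightarrow> nat \<Rightarrow> nat \<Rightarrow> nat \<Rightarrow> nat \<Rightarrow> bool" where
  "allowed \<B> a b c d \<longleftrightarrow>
     restrict (\<lambda>x. if snd x = 0 then (if fst x = 0 then a else b) else (if fst x = 0 then c else d))
       (rect 2 2) \<in> \<B>"

definition col_adj :: "pattern set \<Rightarrow> nat list \<Rightarrow> nat list \<Rightarrow> bool" where
  "col_adj \<B> u v \<longleftrightarrow>
     (\<forall>t. Suc t < length u \<longrightarrow> allowed \<B> (u ! t) (v ! t) (u ! Suc t) (v ! Suc t))"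

definition row_adj :: "pattern set \<Rightarrow> nat list \<Rightarrow> nat list \<Rightarrow> bool" where
  "row_adj \<B> x y \<longleftrightarrow>
     (\<forall>t. Suc t < length x \<longrightarrow> allowed \<B> (x ! t) (x ! Suc t) (y ! t) (y ! Suc t))"

lemma Suc_less_Cons2:
  "(\<forall>t. Suc t < length (a # c # u) \<longrightarrow> P t) \<longleftrightarrow> P 0 \<and> (\<forall>t. Suc t < length (c # u) \<longrightarrow> P (Suc t))"
  by (auto simp: less_Suc_eq_0_disj)

lemma col_adj_single [simp]: "col_adj \<B> [a] [b]"
  by (simp add: col_adj_def)

lemma col_adj_Cons2 [simp]:
  "col_adj \<B> (a # c # u) (b # d # v) \<longleftrightarrow> allowed \<B> a b c d \<and> col_adj \<B> (c # u) (d # v)"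
  unfolding col_adj_def Suc_less_Cons2 by simp

lemma row_adj_Cons2 [simp]:
  "row_adj \<B> (a # b # x) (c # d # y) \<longleftrightarrow> allowed \<B> a b c d \<and> row_adj \<B> (b # x) (d # y)"
  unfolding row_adj_def Suc_less_Cons2 by simp

lemma words_Nil [simp]: "[] \<in> words p n \<longleftrightarrow> n = 0"
  by (auto simp: words_def)

lemma words_Cons [simp]: "a # w \<in> words p n \<longleftrightarrow> a < p \<and> n > 0 \<and> w \<in> words p (n - 1)"
  by (auto simp: words_def)

lemma words_0 [simp]: "words p 0 = {[]}"
  by (auto simp: words_def)

lemma words_length: "w \<in> words p n \<Longrightarrow> length w = n"
  by (simp add: words_def)

lemma words_append: "u \<in> words p k \<Longrightarrow> z \<in> words p l \<Longrightarrow> u @ z \<in> words p (k + l)"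
  by (auto simp: words_def)

lemma words_SucE:
  assumes "w \<in> words p (Suc n)"
  obtains a w' where "w = a # w'" "a < p" "w' \<in> words p n"
  using assms by (cases w) auto

text \<open>Words \<open>u\<close> and \<open>v\<close> of length \<open>k\<close> are the outer columns of an admissible pattern of height
  \<open>k + 1\<close> whose bottom row is \<open>js\<close>; the columns \<open>u\<close> and \<open>v\<close> do not include the bottom row.\<close>

fun filled :: "nat \<Rightarrow> pattern set \<Rightarrow> nat \<Rightarrow> nat list \<Rightarrow> nat list \<Rightarrow> nat list \<Rightarrow> bool" where
  "filled p \<B> k [] u v = False"
| "filled p \<B> k [j] u v = (u = v)"
| "filled p \<B> k (i # j # js) u v =
     (\<exists>w \<in> words p k. col_adj \<B> (i # u) (j # w) \<and> filled p \<B> k (j # js) w v)"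

text \<open>The row \<open>y\<close> stops being the bottom row and becomes the lowest letter of
  every column, so each outer column gains its letter of \<open>y\<close>. The induction runs along
  the row and puts one square between \<open>x\<close> and \<open>y\<close> below each pair of
  columns. The intermediate columns stay words because the letters of \<open>y\<close> are below
  \<open>p\<close>.\<close>

lemma filled_up:
  assumes "row_adj \<B> x y" "length x = length y" "filled p \<B> k y u v" "set y \<subseteq> {..<p}"
  shows "filled p \<B> (Suc k) x (hd y # u) (last y # v)"
  using assms
proof (induction x arbitrary: y u)
  case Nil
  then show ?case by auto
next
  case (Cons a x)
  then obtain c y' where y: "y = c # y'" by (cases y) auto
  show ?case
  proof (cases x)
    case Nil
    with Cons y show ?thesis by auto
  next
    case (Cons b x')
    with Cons.prems y obtain d y'' where y': "y' = d # y''" by (cases y') auto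
    from Cons.prems(3) y y' obtain w where w: "w \<in> words p k"
      "col_adj \<B> (c # u) (d # w)" "filled p \<B> k (d # y'') w v" by auto
    from Cons.prems Cons y y' w have "filled p \<B> (Suc k) x (hd y' # w) (last y' # v)"
      by (intro Cons.IH) auto
    moreover from Cons.prems Cons y y' w have "col_adj \<B> (a # c # u) (b # d # w)" "d < p" by auto
    ultimately show ?thesis using w(1) y y' Cons
      by (auto intro!: bexI[of _ "d # w"])
  qed
qed

text \<open>Iterates \<open>filled_up\<close>. The induction shifts the chain by one, so
  \<open>x 0\<close> is inserted last and the letters of \<open>x 1\<close> come first in the outer
  columns.\<close>

lemma filled_up_chain:
  assumes "\<And>i. i < q \<Longrightarrow> row_adj \<B> (x i) (x (Suc i))"
    and "\<And>i. i \<le> q \<Longrightarrow> length (x i) = r"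
    and "\<And>i. i \<le> q \<Longrightarrow> set (x i) \<subseteq> {..<p}"
    and "filled p \<B> k (x q) u v"
  shows "filled p \<B> (q + k) (x 0) (map (\<lambda>i. hd (x (Suc i))) [0..<q] @ u)
           (map (\<lambda>i. last (x (Suc i))) [0..<q] @ v)"
  using assms
proof (induction q arbitrary: x)
  case 0
  then show ?case by simp
next
  case (Suc q)
  have "filled p \<B> (q + k) (x (Suc 0)) (map (\<lambda>i. hd (x (Suc (Suc i)))) [0..<q] @ u)
           (map (\<lambda>i. last (x (Suc (Suc i)))) [0..<q] @ v)"
    using Suc.prems by (intro Suc.IH[of "\<lambda>i. x (Suc i)"]) auto
  then have "filled p \<B> (Suc (q + k)) (x 0)
      (hd (x (Suc 0)) # map (\<lambda>i. hd (x (Suc (Suc i)))) [0..<q] @ u)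
      (last (x (Suc 0)) # map (\<lambda>i. last (x (Suc (Suc i)))) [0..<q] @ v)"
    using Suc.prems by (intro filled_up) auto
  then show ?case
    by (simp add: map_upt_Suc del: upt_Suc)
qed

section \<open>Completing partial fillings upwards\<close>

text \<open>The form in which non-degeneracy is applied: in each block of \<open>H_2\<close> the
  first clause excludes zero rows, the second zero columns.\<close>

definition extendable :: "nat \<Rightarrow> pattern set \<Rightarrow> bool" where
  "extendable p \<B> \<longleftrightarrow>
     (\<forall>a<p. \<forall>b<p. \<forall>c<p. \<exists>d<p. allowed \<B> a b c d) \<and>
     (\<forall>a<p. \<forall>b<p. \<forall>d<p. \<exists>c<p. allowed \<B> a b c d)"

text \<open>The induction on \<open>k\<close> climbs to the top of the given columns. From there an
  induction on \<open>l\<close> chooses one letter at a time: the lower corners and the upper left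
  corner of the next square are known, and \<open>extendable\<close> supplies the upper right
  one.\<close>

lemma col_adj_extend_right:
  assumes "extendable p \<B>" "z \<in> words p l" "col_adj \<B> (a # u) (b # v)"
    and "a < p" "b < p" "u \<in> words p k" "v \<in> words p k"
  shows "\<exists>z' \<in> words p l. col_adj \<B> (a # u @ z) (b # v @ z')"
  using assms(2-)
proof (induction k arbitrary: a b u v)
  case (Suc k)
  obtain c u1 d v1 where uv: "u = c # u1" "v = d # v1" "c < p" "d < p" "u1 \<in> words p k" "v1 \<in> words p k"
    using Suc.prems by (auto elim!: words_SucE)
  have "\<exists>z' \<in> words p l. col_adj \<B> (c # u1 @ z) (d # v1 @ z')"
    using Suc.prems uv by (intro Suc.IH) auto
  with Suc.prems uv show ?case by auto
next
  case 0
  then show ?case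
  proof (induction l arbitrary: a b z)
    case (Suc l)
    from Suc.prems(1) obtain c z1 where z: "z = c # z1" "c < p" "z1 \<in> words p l"
      by (elim words_SucE)
    from assms(1) z Suc.prems obtain d where d: "d < p" "allowed \<B> a b c d"
      unfolding extendable_def by blast
    from Suc.IH[of z1 c d] Suc.prems z d obtain z' where "z' \<in> words p l" "col_adj \<B> (c # z1) (d # z')"
      by auto
    then show ?case using Suc.prems z d by (auto intro!: bexI[of _ "d # z'"])
  qed auto
qed

text \<open>Mirror image of \<open>col_adj_extend_right\<close>, by the second clause of
  \<open>extendable\<close>.\<close>

lemma col_adj_extend_left:
  assumes "extendable p \<B>" "z' \<in> words p l" "col_adj \<B> (a # u) (b # v)"
    and "a < p" "b < p" "u \<in> words p k" "v \<in> words p k"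
  shows "\<exists>z \<in> words p l. col_adj \<B> (a # u @ z) (b # v @ z')"
  using assms(2-)
proof (induction k arbitrary: a b u v)
  case (Suc k)
  obtain c u1 d v1 where uv: "u = c # u1" "v = d # v1" "c < p" "d < p" "u1 \<in> words p k" "v1 \<in> words p k"
    using Suc.prems by (auto elim!: words_SucE)
  have "\<exists>z \<in> words p l. col_adj \<B> (c # u1 @ z) (d # v1 @ z')"
    using Suc.prems uv by (intro Suc.IH) auto
  with Suc.prems uv show ?case by auto
next
  case 0
  then show ?case
  proof (induction l arbitrary: a b z')
    case (Suc l)
    from Suc.prems(1) obtain d z1 where z: "z' = d # z1" "d < p" "z1 \<in> words p l"
      by (elim words_SucE)
    from assms(1) z Suc.prems obtain c where c: "c < p" "allowed \<B> a b c d"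
      unfolding extendable_def by blast
    from Suc.IH[of z1 c d] Suc.prems z c obtain z where "z \<in> words p l" "col_adj \<B> (c # z) (d # z1)"
      by auto
    then show ?case using Suc.prems z c by (auto intro!: bexI[of _ "c # z"])
  qed auto
qed

text \<open>The completion spreads from left to right: the new top of each column is the prescribed
  left side for the next pair.\<close>

lemma filled_extend_right:
  assumes "extendable p \<B>" "set x \<subseteq> {..<p}" "u \<in> words p k" "v \<in> words p k"
    and "z \<in> words p l" "filled p \<B> k x u v"
  shows "\<exists>z' \<in> words p l. filled p \<B> (k + l) x (u @ z) (v @ z')"
  using assms
proof (induction p \<B> k x u v arbitrary: z rule: filled.induct)
  case (3 p \<B> k i j js u v)
  then obtain w where w: "w \<in> words p k" "col_adj \<B> (i # u) (j # w)" "filled p \<B> k (j # js) w v"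
    by auto
  obtain z1 where z1: "z1 \<in> words p l" "col_adj \<B> (i # u @ z) (j # w @ z1)"
    using col_adj_extend_right[of p \<B> z l i u j w k] 3 w by auto
  obtain z2 where "z2 \<in> words p l" "filled p \<B> (k + l) (j # js) (w @ z1) (v @ z2)"
    using "3.IH"[of w z1] "3.prems"(1-5) w z1 by auto
  then show ?case using z1 w by (intro bexI[of _ z2]) (auto intro!: bexI[of _ "w @ z1"] words_append)
qed auto

text \<open>Here the completion spreads from right to left, so the induction hypothesis is applied
  before the leftmost pair is treated.\<close>

lemma filled_extend_left:
  assumes "extendable p \<B>" "set x \<subseteq> {..<p}" "u \<in> words p k" "v \<in> words p k"
    and "z' \<in> words p l" "filled p \<B> k x u v"
  shows "\<exists>z \<in> words p l. filled p \<B> (k + l) x (u @ z) (v @ z')"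
  using assms
proof (induction p \<B> k x u v arbitrary: z' rule: filled.induct)
  case (3 p \<B> k i j js u v)
  then obtain w where w: "w \<in> words p k" "col_adj \<B> (i # u) (j # w)" "filled p \<B> k (j # js) w v"
    by auto
  obtain z1 where z1: "z1 \<in> words p l" "filled p \<B> (k + l) (j # js) (w @ z1) (v @ z')"
    using "3.IH"[of w z'] "3.prems"(1-5) w by auto
  obtain z2 where "z2 \<in> words p l" "col_adj \<B> (i # u @ z2) (j # w @ z1)"
    using col_adj_extend_left[of p \<B> z1 l i u j w k] 3 w z1 by auto
  then show ?case using z1 w by (intro bexI[of _ z2]) (auto intro!: bexI[of _ "w @ z1"] words_append)
qed auto

section \<open>Primitivity of the strip relations\<close>

text \<open>\<open>k\<close> does not count the bottom row: for the rows \<open>X\<close> in the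
  final proof this is the support of \<open>A_n\<close> with \<open>n = k + 1\<close>.\<close>

definition strip_rel :: "nat \<Rightarrow> pattern set \<Rightarrow> nat list set \<Rightarrow> nat \<Rightarrow> nat list rel" where
  "strip_rel p \<B> X k = {(u, v). u \<in> words p k \<and> v \<in> words p k \<and> (\<exists>x \<in> X. filled p \<B> k x u v)}"

definition col_rel :: "nat \<Rightarrow> pattern set \<Rightarrow> nat \<Rightarrow> nat list rel" where
  "col_rel p \<B> n = {(u, v). u \<in> words p n \<and> v \<in> words p n \<and> col_adj \<B> u v}"

text \<open>For a non-negative matrix, positivity of the entries of a power depends only on the
  support, so primitivity can be treated as a property of a relation.\<close>

definition primitive_rel :: "'a set \<Rightarrow> 'a rel \<Rightarrow> bool" where
  "primitive_rel A r \<longleftrightarrow> (\<exists>N \<ge> 1. \<forall>n \<ge> N. A \<times> A \<subseteq> r ^^ n)"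

text \<open>The top found at the right end of one strip is the prescribed top at the left end of the
  next.\<close>

lemma relpow_strip_extend_right:
  assumes "extendable p \<B>" "\<forall>x \<in> X. set x \<subseteq> {..<p}"
    and "z \<in> words p l" "(u, v) \<in> strip_rel p \<B> X k ^^ N"
  shows "\<exists>z' \<in> words p l. (u @ z, v @ z') \<in> strip_rel p \<B> X (k + l) ^^ N"
  using assms(4)
proof (induction N arbitrary: v)
  case 0
  then show ?case using assms by auto
next
  case (Suc N)
  then obtain w where w: "(u, w) \<in> strip_rel p \<B> X k ^^ N" "(w, v) \<in> strip_rel p \<B> X k" by auto
  from Suc.IH[OF w(1)] obtain z1 where
    z1: "z1 \<in> words p l" "(u @ z, w @ z1) \<in> strip_rel p \<B> X (k + l) ^^ N" by auto
  obtain x where x: "x \<in> X" "filled p \<B> k x w v" "w \<in> words p k" "v \<in> words p k"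
    using w(2) by (auto simp: strip_rel_def)
  from filled_extend_right[OF assms(1) bspec[OF assms(2) x(1)] x(3,4) z1(1) x(2)] obtain z2 where
    "z2 \<in> words p l" "filled p \<B> (k + l) x (w @ z1) (v @ z2)" by auto
  moreover from this x z1 have "(w @ z1, v @ z2) \<in> strip_rel p \<B> X (k + l)"
    by (auto simp: strip_rel_def words_append)
  ultimately show ?case using z1 by auto
qed

text \<open>The tops are found from the last strip back to the first, hence \<open>z'\<close> varies
  in the induction.\<close>

lemma relpow_strip_extend_left:
  assumes "extendable p \<B>" "\<forall>x \<in> X. set x \<subseteq> {..<p}"
    and "z' \<in> words p l" "(u, v) \<in> strip_rel p \<B> X k ^^ N"
  shows "\<exists>z \<in> words p l. (u @ z, v @ z') \<in> strip_rel p \<B> X (k + l) ^^ N"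
  using assms(3,4)
proof (induction N arbitrary: v z')
  case 0
  then show ?case by auto
next
  case (Suc N)
  then obtain w where w: "(u, w) \<in> strip_rel p \<B> X k ^^ N" "(w, v) \<in> strip_rel p \<B> X k" by auto
  obtain x where x: "x \<in> X" "filled p \<B> k x w v" "w \<in> words p k" "v \<in> words p k"
    using w(2) by (auto simp: strip_rel_def)
  from filled_extend_left[OF assms(1) bspec[OF assms(2) x(1)] x(3,4) Suc.prems(1) x(2)] obtain z1 where
    z1: "z1 \<in> words p l" "filled p \<B> (k + l) x (w @ z1) (v @ z')" by auto
  from Suc.IH[OF z1(1) w(1)] obtain z where
    "z \<in> words p l" "(u @ z, w @ z1) \<in> strip_rel p \<B> X (k + l) ^^ N" by auto
  moreover from x z1 Suc.prems have "(w @ z1, v @ z') \<in> strip_rel p \<B> X (k + l)"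
    by (auto simp: strip_rel_def words_append)
  ultimately show ?case by auto
qed

text \<open>Serves twice: with \<open>m = 1\<close> for putting the prefix \<open>c\<close> in front
  of words, and with \<open>m\<close> the number of column steps in a strip for reading strips as
  paths of columns.\<close>

lemma relpow_image:
  assumes "\<And>u v. (u, v) \<in> r \<Longrightarrow> (f u, f v) \<in> s ^^ m" and "(u, v) \<in> r ^^ N"
  shows "(f u, f v) \<in> s ^^ (m * N)"
  using assms(2)
proof (induction N arbitrary: v)
  case (Suc N)
  then obtain w where "(f u, f w) \<in> s ^^ (m * N)" "(f w, f v) \<in> s ^^ m"
    using assms(1) by auto
  then have "(f u, f v) \<in> s ^^ (m * N + m)" by (auto simp: relpow_add)
  then show ?case by (simp add: add.commute)
qed auto

text \<open>Words with prefix \<open>c\<close> form a copy of the primitive relation on the shorter words; the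
  primitive relation on prefixes, extended upwards, leads into and out of this copy.\<close>

lemma primitive_strip_rel_append:
  assumes "extendable p \<B>" "\<forall>x \<in> X. set x \<subseteq> {..<p}" "c \<in> words p q"
    and lift: "\<And>u v. (u, v) \<in> strip_rel p \<B> X k \<Longrightarrow> (c @ u, c @ v) \<in> strip_rel p \<B> X (q + k)"
    and "primitive_rel (words p q) (strip_rel p \<B> X q)"
    and "primitive_rel (words p k) (strip_rel p \<B> X k)"
  shows "primitive_rel (words p (q + k)) (strip_rel p \<B> X (q + k))"
proof -
  let ?R = "strip_rel p \<B> X"
  obtain M where M: "words p q \<times> words p q \<subseteq> ?R q ^^ M"
    using assms(5) unfolding primitive_rel_def by blast
  obtain N where N: "N \<ge> 1" "\<And>n. n \<ge> N \<Longrightarrow> words p k \<times> words p k \<subseteq> ?R k ^^ n"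
    using assms(6) unfolding primitive_rel_def by blast
  have "(u, v) \<in> ?R (q + k) ^^ n"
    if n: "n \<ge> M + N + M" and uv: "u \<in> words p (q + k)" "v \<in> words p (q + k)" for u v n
  proof -
    \<comment> \<open>The path spends \<open>M\<close> steps on turning the prefix of
      \<open>u\<close> into \<open>c\<close>, \<open>i\<close> steps among the words with prefix
      \<open>c\<close>, and \<open>M\<close> steps on turning \<open>c\<close> into the prefix of
      \<open>v\<close>. Only \<open>i\<close> varies with \<open>n\<close>.\<close>
    define i where "i = n - (M + M)"
    have i: "n = M + i + M" "i \<ge> N" using n by (auto simp: i_def)
    have split: "take q w \<in> words p q \<and> drop q w \<in> words p k" if "w \<in> words p (q + k)" for w
      using that by (auto simp: words_def dest: in_set_takeD in_set_dropD)
    have "(take q u, c) \<in> ?R q ^^ M" "(c, take q v) \<in> ?R q ^^ M"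
      using M assms(3) split uv by auto
    then have
      "\<exists>z \<in> words p k. (take q u @ drop q u, c @ z) \<in> ?R (q + k) ^^ M"
      "\<exists>z' \<in> words p k. (c @ z', take q v @ drop q v) \<in> ?R (q + k) ^^ M"
      using split uv
      by (intro relpow_strip_extend_right[OF assms(1,2)] relpow_strip_extend_left[OF assms(1,2)];
          simp)+
    then obtain z z' where z: "z \<in> words p k" "z' \<in> words p k"
      and in_out: "(u, c @ z) \<in> ?R (q + k) ^^ M" "(c @ z', v) \<in> ?R (q + k) ^^ M"
      by auto
    \<comment> \<open>The words \<open>z\<close> and \<open>z'\<close> above \<open>c\<close> cannot
      be prescribed, but primitivity at height \<open>k\<close> joins any two words in exactly
      \<open>i\<close> steps.\<close>
    have "(z, z') \<in> ?R k ^^ i" using N(2)[OF i(2)] z by auto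
    then have "(c @ z, c @ z') \<in> ?R (q + k) ^^ (1 * i)"
      by (rule relpow_image[where f = "\<lambda>w. c @ w", rotated]) (simp add: lift)
    with in_out show ?thesis
      unfolding i(1) relpow_add by auto
  qed
  then show ?thesis using N(1) unfolding primitive_rel_def
    by (intro exI[of _ "M + N + M"]) auto
qed

text \<open>Strong induction on \<open>k\<close>: heights up to \<open>q\<close> are given, and a
  larger one loses a prefix of length \<open>q\<close>.\<close>

lemma primitive_strip_rel_all:
  assumes "extendable p \<B>" "\<forall>x \<in> X. set x \<subseteq> {..<p}" "c \<in> words p q" "q \<ge> 1"
    and "\<And>k u v. (u, v) \<in> strip_rel p \<B> X k \<Longrightarrow> (c @ u, c @ v) \<in> strip_rel p \<B> X (q + k)"
    and "\<And>k. 1 \<le> k \<Longrightarrow> k \<le> q \<Longrightarrow> primitive_rel (words p k) (strip_rel p \<B> X k)"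
    and "k \<ge> 1"
  shows "primitive_rel (words p k) (strip_rel p \<B> X k)"
  using assms(7)
proof (induction k rule: less_induct)
  case (less k)
  show ?case
  proof (cases "k \<le> q")
    case False
    define k' where "k' = k - q"
    have k: "k = q + k'" "k' \<ge> 1" "k' < k" using False assms(4) by (auto simp: k'_def)
    have "primitive_rel (words p (q + k')) (strip_rel p \<B> X (q + k'))"
    proof (rule primitive_strip_rel_append[OF assms(1-3)])
      show "(c @ u, c @ v) \<in> strip_rel p \<B> X (q + k')" if "(u, v) \<in> strip_rel p \<B> X k'" for u v
        by (rule assms(5)[OF that])
      show "primitive_rel (words p q) (strip_rel p \<B> X q)" using assms(4,6) by blast
      show "primitive_rel (words p k') (strip_rel p \<B> X k')" using less.IH k by blast
    qed
    then show ?thesis using k by simp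
  qed (use assms(6) less.prems in auto)
qed

section \<open>From strips to columns that include the bottom letter\<close>

text \<open>Read from left to right, the columns of a filled strip, each with its bottom letter in
  front, form a path with one step per pair of neighbouring letters of \<open>x\<close>.\<close>

lemma filled_relpow_col_rel:
  assumes "filled p \<B> k x u v" "set x \<subseteq> {..<p}" "u \<in> words p k" "v \<in> words p k"
  shows "(hd x # u, last x # v) \<in> col_rel p \<B> (Suc k) ^^ (length x - 1)"
  using assms
proof (induction p \<B> k x u v rule: filled.induct)
  case (3 p \<B> k i j js u v)
  then obtain w where w: "w \<in> words p k" "col_adj \<B> (i # u) (j # w)" "filled p \<B> k (j # js) w v"
    by auto
  with 3 have "(j # w, last (j # js) # v) \<in> col_rel p \<B> (Suc k) ^^ length js" by fastforce
  moreover from w 3 have "(i # u, j # w) \<in> col_rel p \<B> (Suc k)" by (auto simp: col_rel_def)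
  ultimately show ?case by (simp add: relpow_Suc_I2 del: relpow.simps(2))
qed auto

text \<open>Strips begin and end at the bottom letter \<open>b\<close>, so they give paths among the
  words starting with \<open>b\<close>, but only of lengths that are multiples of \<open>m\<close>.
  The freely chosen time for entering this set makes up for the other lengths.\<close>

lemma primitive_col_rel:
  assumes "extendable p \<B>" "b < p"
    and X: "\<And>x. x \<in> X \<Longrightarrow> set x \<subseteq> {..<p} \<and> length x = Suc m \<and> hd x = b \<and> last x = b"
    and primitive: "primitive_rel (words p k) (strip_rel p \<B> X k)"
  shows "primitive_rel (words p (Suc k)) (col_rel p \<B> (Suc k))"
proof -
  let ?G = "col_rel p \<B> (Suc k)"
  obtain N where N: "\<And>n. n \<ge> N \<Longrightarrow> words p k \<times> words p k \<subseteq> strip_rel p \<B> X k ^^ n"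
    using primitive unfolding primitive_rel_def by blast
  have loop: "(b # u, b # v) \<in> ?G ^^ (m * n)" if "n \<ge> N" "u \<in> words p k" "v \<in> words p k" for u v n
  proof (rule relpow_image[where f = "\<lambda>w. b # w" and r = "strip_rel p \<B> X k"])
    show "(u, v) \<in> strip_rel p \<B> X k ^^ n" using N that by auto
    fix u v assume "(u, v) \<in> strip_rel p \<B> X k"
    then show "(b # u, b # v) \<in> ?G ^^ m"
      using X filled_relpow_col_rel[of p \<B> k _ u v] by (fastforce simp: strip_rel_def)
  qed
  have enter: "\<exists>u' \<in> words p k. (u, b # u') \<in> ?G ^^ Suc r" if u: "u \<in> words p (Suc k)" for u r
    using u
  proof (induction r arbitrary: u)
    case 0
    then obtain a z where z: "u = a # z" "a < p" "z \<in> words p k" by (elim words_SucE)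
    with col_adj_extend_right[OF assms(1) z(3), of a "[]" b "[]" 0] assms(2)
    show ?case by (auto simp: col_rel_def)
  next
    case (Suc r)
    from Suc.IH[OF Suc.prems] obtain u' where u': "u' \<in> words p k" "(u, b # u') \<in> ?G ^^ Suc r"
      by auto
    \<comment> \<open>Squares with bottom row \<open>b b\<close> allow a step that keeps the bottom
      letter \<open>b\<close>, so the path can wait there for as long as required.\<close>
    from col_adj_extend_right[OF assms(1) u'(1), of b "[]" b "[]" 0] assms(2) obtain z where
      "z \<in> words p k" "(b # u', b # z) \<in> ?G" using u' by (auto simp: col_rel_def)
    with u' show ?case by (metis relpow_Suc_I)
  qed
  have leave: "\<exists>v' \<in> words p k. (b # v', v) \<in> ?G" if v: "v \<in> words p (Suc k)" for v
  proof -
    from v obtain a z where z: "v = a # z" "a < p" "z \<in> words p k" by (elim words_SucE)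
    with col_adj_extend_left[OF assms(1) z(3), of b "[]" a "[]" 0] assms(2)
    show ?thesis by (auto simp: col_rel_def)
  qed
  have "(u, v) \<in> ?G ^^ n" if n: "n \<ge> m * N + 2" and uv: "u \<in> words p (Suc k)" "v \<in> words p (Suc k)"
    for n u v
  proof -
    \<comment> \<open>The loop has the fixed length \<open>m * N\<close> and leaving takes one step;
      entering takes all the rest.\<close>
    define r where "r = n - (m * N + 2)"
    have r: "n = Suc r + m * N + 1" using n by (simp add: r_def)
    obtain u' v' where "u' \<in> words p k" "(u, b # u') \<in> ?G ^^ Suc r" "v' \<in> words p k" "(b # v', v) \<in> ?G"
      using enter leave uv by meson
    with loop[of N u' v'] show ?thesis
      unfolding r relpow_add by (auto simp del: relpow.simps(2) One_nat_def)
  qed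
  then show ?thesis unfolding primitive_rel_def
    by (intro exI[of _ "m * N + 2"]) auto
qed


section \<open>The counting function as a bijection\<close>

definition idx :: "nat \<Rightarrow> nat list \<Rightarrow> nat" where
  "idx p w = psi p w - 1"

lemma psi_Nil [simp]: "psi p [] = 1"
  by (simp add: psi_def)

lemma psi_Cons: "psi p (a # w) = a * p ^ length w + psi p w"
proof -
  have "(\<Sum>k = 1..Suc (length w). (a # w) ! (k - 1) * p ^ (Suc (length w) - k)) =
    a * p ^ length w + (\<Sum>k = Suc 1..Suc (length w). (a # w) ! (k - 1) * p ^ (Suc (length w) - k))"
    by (subst sum.atLeast_Suc_atMost) auto
  also have "(\<Sum>k = Suc 1..Suc (length w). (a # w) ! (k - 1) * p ^ (Suc (length w) - k)) =
    (\<Sum>k = 1..length w. w ! (k - 1) * p ^ (length w - k))"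
    by (subst sum.shift_bounds_cl_Suc_ivl) (auto intro!: sum.cong simp: nth_Cons')
  finally show ?thesis by (simp add: psi_def)
qed

lemma psi_eq_idx: "psi p w = Suc (idx p w)"
  by (simp add: idx_def psi_def)

lemma idx_Nil [simp]: "idx p [] = 0"
  by (simp add: idx_def)

text \<open>The leading letter numbers the block and the remaining word gives the position in it;
  \<open>H_block_pos_iff\<close> rests on this.\<close>

lemma idx_Cons: "idx p (a # w) = a * p ^ length w + idx p w"
  using psi_Cons[of p a w] by (simp add: psi_eq_idx)

lemma idx_less: "w \<in> words p n \<Longrightarrow> idx p w < p ^ n"
proof (induction n arbitrary: w)
  case (Suc n)
  then obtain a v where w: "w = a # v" "a < p" "v \<in> words p n" by (elim words_SucE)
  have "a * p ^ n + idx p v < Suc a * p ^ n" using Suc.IH[OF w(3)] by simp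
  also have "\<dots> \<le> p * p ^ n" using w(2) by (intro mult_right_mono) auto
  finally show ?case using w by (simp add: idx_Cons words_length)
qed auto

lemma inj_on_idx: "inj_on (idx p) (words p n)"
proof (induction n)
  case (Suc n)
  show ?case
  proof (rule inj_onI)
    fix x y assume xy: "x \<in> words p (Suc n)" "y \<in> words p (Suc n)" "idx p x = idx p y"
    then obtain a v b w where s: "x = a # v" "v \<in> words p n" "y = b # w" "w \<in> words p n"
      by (elim words_SucE)
    have e: "a * p ^ n + idx p v = b * p ^ n + idx p w"
      using xy s by (simp add: idx_Cons words_length)
    have l: "idx p v < p ^ n" "idx p w < p ^ n" using s idx_less by auto
    \<comment> \<open>The rest is below \<open>p ^ n\<close>, so division recovers the leading
      letter.\<close>
    have "(a * p ^ n + idx p v) div p ^ n = a" "(b * p ^ n + idx p w) div p ^ n = b"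
      using l by (auto intro!: div_nat_eqI simp: algebra_simps)
    with e have "a = b" by metis
    with e s Suc.IH show "x = y" by (auto dest: inj_onD)
  qed
qed auto

lemma finite_words: "finite (words p n)"
  using finite_lists_length_eq[of "{..<p}" n] by (simp add: words_def conj_commute)

lemma card_words: "card (words p n) = p ^ n"
  using card_lists_length_eq[of "{..<p}" n] by (simp add: words_def conj_commute)

lemma bij_betw_idx: "bij_betw (idx p) (words p n) {..<p ^ n}"
proof -
  have "idx p ` words p n = {..<p ^ n}"
    by (rule card_subset_eq) (auto simp: card_image inj_on_idx card_words idx_less)
  then show ?thesis by (simp add: bij_betw_def inj_on_idx)
qed

lemma psi_image: "psi p ` words p n = {1..p ^ n}"
proof -
  have "psi p ` words p n = Suc ` idx p ` words p n" by (simp add: image_image psi_eq_idx)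
  also have "\<dots> = {1..p ^ n}"
    using bij_betw_idx[of p n]
    by (simp add: bij_betw_def image_Suc_lessThan)
  finally show ?thesis .
qed

lemma inj_on_psi: "inj_on (psi p) (words p n)"
  using inj_on_idx by (simp add: psi_eq_idx inj_on_def)

lemma idx_eq_iff: "u \<in> words p n \<Longrightarrow> v \<in> words p n \<Longrightarrow> idx p u = idx p v \<longleftrightarrow> u = v"
  using inj_on_idx by (auto dest: inj_onD)

lemma word_of_psi: "w \<in> words p n \<Longrightarrow> word_of p n (psi p w) = w"
  unfolding word_of_def by (rule inv_into_f_f[OF inj_on_psi])

lemma word_of_mem: "k \<in> {1..p ^ n} \<Longrightarrow> word_of p n k \<in> words p n"
  unfolding word_of_def psi_image[symmetric] by (rule inv_into_into)

lemma psi_word_of: "k \<in> {1..p ^ n} \<Longrightarrow> psi p (word_of p n k) = k"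
  unfolding word_of_def psi_image[symmetric] by (rule f_inv_into_f)

lemma idx_word_of: "k \<in> {1..p ^ n} \<Longrightarrow> idx p (word_of p n k) = k - 1"
  using psi_word_of[of k p n] by (simp add: idx_def)

lemma all_idx: "(\<forall>i<p ^ n. P i) \<longleftrightarrow> (\<forall>u \<in> words p n. P (idx p u))"
  using bij_betw_ball[OF bij_betw_idx[of p n], of P] by auto

lemma sum_idx: "(\<Sum>i<p ^ n. f i) = (\<Sum>w \<in> words p n. f (idx p w))"
  using sum.reindex_bij_betw[OF bij_betw_idx] by metis

section \<open>Supports of matrices as relations on words\<close>

definition supp_rel :: "nat \<Rightarrow> nat \<Rightarrow> nat mat \<Rightarrow> nat list rel" where
  "supp_rel p n A = {(u, v). u \<in> words p n \<and> v \<in> words p n \<and> A $$ (idx p u, idx p v) > 0}"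

lemma supp_rel_one: "supp_rel p n (1\<^sub>m (p ^ n)) = Id_on (words p n)"
  by (auto simp: supp_rel_def idx_less idx_eq_iff split: if_splits)

text \<open>Entries are natural numbers, so nothing cancels: the sum over the middle index is
  positive iff one of its products is.\<close>

lemma supp_rel_mult:
  assumes "A \<in> carrier_mat (p ^ n) (p ^ n)" "B \<in> carrier_mat (p ^ n) (p ^ n)"
  shows "supp_rel p n (A * B) = supp_rel p n A O supp_rel p n B"
proof -
  have "(A * B) $$ (idx p u, idx p v) > 0 \<longleftrightarrow>
      (\<exists>w \<in> words p n. A $$ (idx p u, idx p w) > 0 \<and> B $$ (idx p w, idx p v) > 0)"
    if "u \<in> words p n" "v \<in> words p n" for u v
  proof -
    have "(A * B) $$ (idx p u, idx p v) =
        (\<Sum>w \<in> words p n. A $$ (idx p u, idx p w) * B $$ (idx p w, idx p v))"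
      using assms that
      by (simp add: scalar_prod_def idx_less atLeast0LessThan sum_idx)
    then show ?thesis by (auto simp: finite_words simp flip: neq0_conv)
  qed
  then show ?thesis by (auto simp: supp_rel_def relcomp_unfold)
qed

text \<open>Stated for words only, because the relational power 0 is the identity on all lists,
  while the unit matrix sees just the words of length \<open>n\<close>.\<close>

lemma supp_rel_pow:
  assumes "A \<in> carrier_mat (p ^ n) (p ^ n)"
  shows "u \<in> words p n \<Longrightarrow> v \<in> words p n \<Longrightarrow>
    (u, v) \<in> supp_rel p n A ^^ N \<longleftrightarrow> (A ^\<^sub>m N) $$ (idx p u, idx p v) > 0"
proof (induction N arbitrary: v)
  case 0
  then show ?case using assms by (auto simp: idx_less idx_eq_iff)
next
  case (Suc N)
  have "(A ^\<^sub>m Suc N) $$ (idx p u, idx p v) > 0 \<longleftrightarrow> (u, v) \<in> supp_rel p n (A ^\<^sub>m N * A)"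
    using Suc.prems by (simp add: supp_rel_def)
  also have "\<dots> \<longleftrightarrow> (u, v) \<in> supp_rel p n (A ^\<^sub>m N) O supp_rel p n A"
    using supp_rel_mult[OF pow_carrier_mat[OF assms] assms] by simp
  also have "\<dots> \<longleftrightarrow> (u, v) \<in> supp_rel p n A ^^ Suc N"
    using Suc by (auto simp: supp_rel_def relcomp_unfold)
  finally show ?case by simp
qed

lemma primitive_mat_iff:
  assumes "A \<in> carrier_mat (p ^ n) (p ^ n)"
  shows "primitive_mat A \<longleftrightarrow> primitive_rel (words p n) (supp_rel p n A)"
  using assms
  by (auto simp: primitive_mat_def primitive_rel_def all_idx supp_rel_pow[OF assms] subset_iff)

lemma mat_prod_list_carrier:
  "(\<And>A. A \<in> set As \<Longrightarrow> A \<in> carrier_mat d d) \<Longrightarrow> mat_prod_list d As \<in> carrier_mat d d"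
  unfolding mat_prod_list_def by (induction As) (auto intro!: mult_carrier_mat[of _ d d])

lemma mat_prod_list_simps [simp]:
  "mat_prod_list d [] = 1\<^sub>m d"
  "mat_prod_list d (A # As) = A * mat_prod_list d As"
  by (simp_all add: mat_prod_list_def)

section \<open>Patterns on rectangles and the matrices \<open>H_n\<close>\<close>

lemma mem_rect: "(x, y) \<in> rect m n \<longleftrightarrow> (\<exists>a<m. \<exists>b<n. x = int a \<and> y = int b)"
  by (auto simp: rect_at_def)

lemma mem_rect_simps [simp]:
  "(int a, int b) \<in> rect m n \<longleftrightarrow> a < m \<and> b < n"
  "(0, int b) \<in> rect m n \<longleftrightarrow> 0 < m \<and> b < n"
  "(1, int b) \<in> rect m n \<longleftrightarrow> 1 < m \<and> b < n"
  "(int a, 0) \<in> rect m n \<longleftrightarrow> a < m \<and> 0 < n"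
  "(int a, 1) \<in> rect m n \<longleftrightarrow> a < m \<and> 1 < n"
  unfolding mem_rect by (auto intro: exI[of _ "0::nat"] exI[of _ "1::nat"])

lemma window_mem_iff:
  "window U (int a, int b) \<in> \<B> \<longleftrightarrow>
     allowed \<B> (U (int a, int b)) (U (int (Suc a), int b))
       (U (int a, int (Suc b))) (U (int (Suc a), int (Suc b)))"
proof -
  have "window U (int a, int b) =
    restrict (\<lambda>x. if snd x = 0
      then (if fst x = 0 then U (int a, int b) else U (int (Suc a), int b))
      else (if fst x = 0 then U (int a, int (Suc b)) else U (int (Suc a), int (Suc b)))) (rect 2 2)"
    unfolding window_def
    by (rule restrict_ext) (auto simp: rect_at_def less_2_cases_iff add.commute)
  then show ?thesis by (simp only: allowed_def)
qed

lemma rect_at_subset: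
  "rect_at 2 2 c \<subseteq> rect m n \<longleftrightarrow> (\<exists>a b. c = (int a, int b) \<and> Suc a < m \<and> Suc b < n)"
proof
  assume l: "rect_at 2 2 c \<subseteq> rect m n"
  \<comment> \<open>Two opposite corners of the window already bound its position.\<close>
  have "c \<in> rect_at 2 2 c" "(fst c + 1, snd c + 1) \<in> rect_at 2 2 c"
    by (force simp: rect_at_def prod_eq_iff intro: exI[of _ 0] exI[of _ 1])+
  with l have "c \<in> rect m n" "(fst c + 1, snd c + 1) \<in> rect m n" by auto
  then show "\<exists>a b. c = (int a, int b) \<and> Suc a < m \<and> Suc b < n"
    by (auto simp: rect_at_def)
next
  assume "\<exists>a b. c = (int a, int b) \<and> Suc a < m \<and> Suc b < n"
  then obtain a b where c: "c = (int a, int b)" "Suc a < m" "Suc b < n" by auto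
  show "rect_at 2 2 c \<subseteq> rect m n"
  proof
    fix x assume "x \<in> rect_at 2 2 c"
    then obtain i j where "x = (int (a + i), int (b + j))" "i < 2" "j < 2"
      using c by (auto simp: rect_at_def)
    moreover from this c have "a + i < m" "b + j < n" by linarith+
    ultimately show "x \<in> rect m n" unfolding mem_rect \<open>x = _\<close> by blast
  qed
qed

lemma admissible_rect:
  "admissible \<B> (rect m n) U \<longleftrightarrow> (\<forall>a b. Suc a < m \<longrightarrow> Suc b < n \<longrightarrow>
     allowed \<B> (U (int a, int b)) (U (int (Suc a), int b))
       (U (int a, int (Suc b))) (U (int (Suc a), int (Suc b))))"
  unfolding admissible_def rect_at_subset window_mem_iff[symmetric] by blast

lemma patterns_less: "U \<in> patterns p R \<Longrightarrow> x \<in> R \<Longrightarrow> U x < p"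
  unfolding patterns_def by (auto dest: PiE_mem)

text \<open>Turns the equations between indices in the definitions of the matrices into equations
  between words, by injectivity of \<open>psi\<close> on words over the letters below
  \<open>p\<close>.\<close>

lemma Suc_idx_eq_psi_map:
  assumes "w \<in> words p (length xs)" "\<And>x. x \<in> set xs \<Longrightarrow> f x < p"
  shows "Suc (idx p w) = psi p (map f xs) \<longleftrightarrow> w = map f xs"
proof -
  have "map f xs \<in> words p (length xs)" using assms(2) by (auto simp: words_def)
  then show ?thesis using assms(1) by (simp add: psi_eq_idx idx_eq_iff)
qed

lemma H_mat_pos_iff:
  assumes "u \<in> words p n" "v \<in> words p n"
  shows "H_mat p \<B> n $$ (idx p u, idx p v) > 0 \<longleftrightarrow> col_adj \<B> u v"
proof -
  let ?c = "\<lambda>U s. map (\<lambda>t. U (s, int t)) [0..<n]"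
  have "H_mat p \<B> n $$ (idx p u, idx p v) > 0 \<longleftrightarrow>
    (\<exists>U \<in> patterns p (rect 2 n). admissible \<B> (rect 2 n) U \<and>
       Suc (idx p u) = psi p (?c U 0) \<and> Suc (idx p v) = psi p (?c U 1))"
    using assms by (simp add: H_mat_def idx_less)
  also have "\<dots> \<longleftrightarrow> (\<exists>U \<in> patterns p (rect 2 n). admissible \<B> (rect 2 n) U \<and> u = ?c U 0 \<and> v = ?c U 1)"
    by (intro bex_cong refl conj_cong Suc_idx_eq_psi_map) (use assms in \<open>simp_all add: patterns_less\<close>)
  also have "\<dots> \<longleftrightarrow> col_adj \<B> u v"
  proof
    assume uv: "col_adj \<B> u v"
    \<comment> \<open>The pattern with left column \<open>u\<close> and right column
      \<open>v\<close>, restricted because \<open>patterns\<close> consists of extensional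
      functions.\<close>
    define U where "U = restrict (\<lambda>x. if fst x = 0 then u ! nat (snd x) else v ! nat (snd x)) (rect 2 n)"
    have U: "U (0, int t) = u ! t" "U (1, int t) = v ! t" if "t < n" for t
      using that by (simp_all add: U_def)
    have "U \<in> patterns p (rect 2 n)"
      using assms by (auto simp: U_def patterns_def mem_rect words_def subset_iff)
    moreover have "u = ?c U 0" "v = ?c U 1"
      using assms U by (auto simp: list_eq_iff_nth_eq words_length)
    moreover have "admissible \<B> (rect 2 n) U"
      \<comment> \<open>Only \<open>int (Suc 0)\<close> is evaluated, to the column number 1; other
        successors stay folded so that the equations \<open>U\<close> match.\<close>
      using uv words_length[OF assms(1)] U unfolding admissible_rect col_adj_def
      by (simp add: less_2_cases_iff of_nat_Suc[of 0] del: of_nat_Suc)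
    ultimately show "\<exists>U \<in> patterns p (rect 2 n). admissible \<B> (rect 2 n) U \<and> u = ?c U 0 \<and> v = ?c U 1"
      by blast
  next
    assume "\<exists>U \<in> patterns p (rect 2 n). admissible \<B> (rect 2 n) U \<and> u = ?c U 0 \<and> v = ?c U 1"
    then obtain U where U: "admissible \<B> (rect 2 n) U" "u = ?c U 0" "v = ?c U 1" by blast
    have "allowed \<B> (U (0, int t)) (U (1, int t)) (U (0, int (Suc t))) (U (1, int (Suc t)))"
      if "Suc t < n" for t
      using U(1)[unfolded admissible_rect, rule_format, of 0 t] that by simp
    then show "col_adj \<B> u v" unfolding U(2,3) col_adj_def by (simp del: of_nat_Suc)
  qed
  finally show ?thesis .
qed

lemma H_mat_carrier: "H_mat p \<B> n \<in> carrier_mat (p ^ n) (p ^ n)"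
  by (simp add: H_mat_def)

lemma supp_rel_H_mat: "supp_rel p n (H_mat p \<B> n) = col_rel p \<B> n"
  by (auto simp: supp_rel_def col_rel_def H_mat_pos_iff)

lemma H_block_pos_iff:
  assumes "i < p" "j < p" "u \<in> words p k" "v \<in> words p k"
  shows "H_block p \<B> (Suc k) (Suc i) (Suc j) $$ (idx p u, idx p v) > 0 \<longleftrightarrow>
    col_adj \<B> (i # u) (j # v)"
  using H_mat_pos_iff[of "i # u" p "Suc k" "j # v" \<B>] assms
  by (simp add: H_block_def idx_less idx_Cons words_length)

lemma H_block_carrier: "H_block p \<B> n i j \<in> carrier_mat (p ^ (n - 1)) (p ^ (n - 1))"
  by (simp add: H_block_def)

lemma row_pos_if_non_compressible:
  fixes A :: "nat mat"
  assumes "non_compressible A" "A \<in> carrier_mat d d" "i < d"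
  shows "\<exists>j<d. A $$ (i, j) > 0" "\<exists>j<d. A $$ (j, i) > 0"
proof -
  have "row A i \<noteq> 0\<^sub>v d" "col A i \<noteq> 0\<^sub>v d" using assms by (auto simp: non_compressible_def)
  then show "\<exists>j<d. A $$ (i, j) > 0" "\<exists>j<d. A $$ (j, i) > 0"
    using assms(2,3) by (auto simp: vec_eq_iff)
qed

lemma extendable_if_non_degenerated:
  assumes "H2_non_degenerated p \<B>"
  shows "extendable p \<B>"
proof -
  have "(\<exists>d<p. allowed \<B> a b c d) \<and> (\<exists>d<p. allowed \<B> a b d c)" if "a < p" "b < p" "c < p" for a b c
  proof -
    let ?A = "H_block p \<B> 2 (Suc a) (Suc b)"
    have w: "[a, b] \<in> words p 2" using that by auto
    then have "psi p [a, b] \<in> {1..p\<^sup>2}" unfolding psi_image[symmetric] by blast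
    with assms have "non_compressible (H_alpha p \<B> 2 (psi p [a, b]))"
      by (auto simp: H2_non_degenerated_def)
    then have "non_compressible ?A" by (simp add: H_alpha_def word_of_psi[OF w])
    moreover have "?A \<in> carrier_mat p p" using H_block_carrier[of p \<B> 2] by simp
    \<comment> \<open>A one-letter word has its letter as index, so \<open>c\<close> and
      \<open>d\<close> number a row and a column of the block.\<close>
    moreover have "?A $$ (c, d) > 0 \<longleftrightarrow> allowed \<B> a b c d" if "c < p" "d < p" for c d
      using H_block_pos_iff[of a p b "[c]" 1 "[d]" \<B>] that \<open>a < p\<close> \<open>b < p\<close>
      by (simp add: idx_Cons numeral_2_eq_2)
    ultimately show ?thesis
      using row_pos_if_non_compressible[of ?A p c] \<open>c < p\<close> by blast
  qed
  then show ?thesis by (auto simp: extendable_def)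
qed


section \<open>Rows and the connecting operator\<close>

lemma psi_eq_iff: "u \<in> words p n \<Longrightarrow> v \<in> words p n \<Longrightarrow> psi p u = psi p v \<longleftrightarrow> u = v"
  by (simp add: psi_eq_idx idx_eq_iff)

lemma ex_pattern_rows_iff:
  assumes "x \<in> words p n" "y \<in> words p n"
  shows "(\<exists>U \<in> patterns p (rect n 2). admissible \<B> (rect n 2) U \<and>
      x = map (\<lambda>a. U (int a, 0)) [0..<n] \<and> y = map (\<lambda>a. U (int a, 1)) [0..<n]) \<longleftrightarrow>
    row_adj \<B> x y"
proof
  assume xy: "row_adj \<B> x y"
  define U where "U = restrict (\<lambda>z. if snd z = 0 then x ! nat (fst z) else y ! nat (fst z)) (rect n 2)"
  have U: "U (int t, 0) = x ! t" "U (int t, 1) = y ! t" if "t < n" for t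
    using that by (simp_all add: U_def)
  have "U \<in> patterns p (rect n 2)"
    using assms by (auto simp: U_def patterns_def mem_rect words_def subset_iff)
  moreover have "x = map (\<lambda>a. U (int a, 0)) [0..<n]" "y = map (\<lambda>a. U (int a, 1)) [0..<n]"
    using assms U by (auto simp: list_eq_iff_nth_eq words_length)
  moreover have "admissible \<B> (rect n 2) U"
    using xy words_length[OF assms(1)] U unfolding admissible_rect row_adj_def
    by (simp add: less_2_cases_iff of_nat_Suc[of 0] del: of_nat_Suc)
  ultimately show "\<exists>U \<in> patterns p (rect n 2). admissible \<B> (rect n 2) U \<and>
      x = map (\<lambda>a. U (int a, 0)) [0..<n] \<and> y = map (\<lambda>a. U (int a, 1)) [0..<n]"
    by blast
next
  assume "\<exists>U \<in> patterns p (rect n 2). admissible \<B> (rect n 2) U \<and>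
      x = map (\<lambda>a. U (int a, 0)) [0..<n] \<and> y = map (\<lambda>a. U (int a, 1)) [0..<n]"
  then obtain U where U: "admissible \<B> (rect n 2) U"
    "x = map (\<lambda>a. U (int a, 0)) [0..<n]" "y = map (\<lambda>a. U (int a, 1)) [0..<n]" by blast
  have "allowed \<B> (U (int t, 0)) (U (int (Suc t), 0)) (U (int t, 1)) (U (int (Suc t), 1))"
    if "Suc t < n" for t
    using U(1)[unfolded admissible_rect, rule_format, of t 0] that by simp
  then show "row_adj \<B> x y" unfolding U(2,3) row_adj_def by (simp del: of_nat_Suc)
qed

text \<open>Each row of the pattern is stored in two pieces, its end letters in the label of the
  matrix and its interior in the index of the entry. The proof regroups the equations by rows and
  joins the pieces.\<close>

lemma S_mat_pos_iff:
  assumes "m \<ge> 1" "a < p" "b < p" "c < p" "d < p" "s \<in> words p (m - 1)" "t \<in> words p (m - 1)"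
  shows "S_mat p \<B> m (psi p [a, b]) (psi p [c, d]) $$ (idx p s, idx p t) > 0 \<longleftrightarrow>
    row_adj \<B> (a # s @ [b]) (c # t @ [d])"
proof -
  let ?r = "\<lambda>U h. map (\<lambda>i. U (int i, h :: int)) [1..<m]"
  have row: "[0..<m + 1] = 0 # [1..<m] @ [m]" using assms(1) by (simp add: upt_conv_Cons[of 0 m])
  have eq: "psi p [a, b] = psi p [U (0, h), U (int m, h)] \<and> Suc (idx p s) = psi p (?r U h) \<longleftrightarrow>
      a # s @ [b] = map (\<lambda>i. U (int i, h)) [0..<m + 1]"
    if U: "U \<in> patterns p (rect (m + 1) 2)" and h: "h = 0 \<or> h = 1"
      and ab: "a < p" "b < p" "s \<in> words p (m - 1)" for U h a b s
  proof -
    have less: "U (int i, h) < p" if "i < m + 1" for i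
      using h that by (intro patterns_less[OF U]) auto
    have "psi p [a, b] = psi p [U (0, h), U (int m, h)] \<longleftrightarrow> [a, b] = [U (0, h), U (int m, h)]"
      using ab less[of 0] less[of m] by (intro psi_eq_iff[of _ p 2]) auto
    moreover have "Suc (idx p s) = psi p (?r U h) \<longleftrightarrow> s = ?r U h"
      using ab less by (intro Suc_idx_eq_psi_map) auto
    moreover have "length s = length (?r U h)" using words_length[OF ab(3)] by simp
    ultimately show ?thesis unfolding row by auto
  qed
  have "S_mat p \<B> m (psi p [a, b]) (psi p [c, d]) $$ (idx p s, idx p t) > 0 \<longleftrightarrow>
    (\<exists>U \<in> patterns p (rect (m + 1) 2). admissible \<B> (rect (m + 1) 2) U \<and>
      psi p [a, b] = psi p [U (0, 0), U (int m, 0)] \<and>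
      psi p [c, d] = psi p [U (0, 1), U (int m, 1)] \<and>
      Suc (idx p s) = psi p (?r U 0) \<and> Suc (idx p t) = psi p (?r U 1))"
    unfolding S_mat_def using idx_less[OF assms(6)] idx_less[OF assms(7)] by simp
  also have "\<dots> \<longleftrightarrow> (\<exists>U \<in> patterns p (rect (m + 1) 2). admissible \<B> (rect (m + 1) 2) U \<and>
      (psi p [a, b] = psi p [U (0, 0), U (int m, 0)] \<and> Suc (idx p s) = psi p (?r U 0)) \<and>
      (psi p [c, d] = psi p [U (0, 1), U (int m, 1)] \<and> Suc (idx p t) = psi p (?r U 1)))"
    by (intro bex_cong refl) argo
  also have "\<dots> \<longleftrightarrow> (\<exists>U \<in> patterns p (rect (m + 1) 2). admissible \<B> (rect (m + 1) 2) U \<and>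
      a # s @ [b] = map (\<lambda>i. U (int i, 0)) [0..<m + 1] \<and>
      c # t @ [d] = map (\<lambda>i. U (int i, 1)) [0..<m + 1])"
    by (intro bex_cong refl conj_cong eq) (use assms in simp_all)
  also have "\<dots> \<longleftrightarrow> row_adj \<B> (a # s @ [b]) (c # t @ [d])"
    using assms words_append[of s p "m - 1" "[b]" 1] words_append[of t p "m - 1" "[d]" 1]
    by (intro ex_pattern_rows_iff) auto
  finally show ?thesis .
qed

lemma S_mat_carrier: "S_mat p \<B> m \<alpha> \<beta> \<in> carrier_mat (p ^ (m - 1)) (p ^ (m - 1))"
  by (simp add: S_mat_def)

section \<open>Products and sums of matrices\<close>

text \<open>Picks the intermediate words behind a positive entry of a product; for the cycle of
  \<open>S\<close> matrices they become the interiors of stacked rows.\<close>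

lemma supp_rel_mat_prod_listD:
  assumes "\<And>A. A \<in> set As \<Longrightarrow> A \<in> carrier_mat (p ^ n) (p ^ n)"
    and "(u, v) \<in> supp_rel p n (mat_prod_list (p ^ n) As)"
  shows "\<exists>f. f 0 = u \<and> f (length As) = v \<and> (\<forall>i \<le> length As. f i \<in> words p n) \<and>
    (\<forall>i < length As. (f i, f (Suc i)) \<in> supp_rel p n (As ! i))"
  using assms
proof (induction As arbitrary: u)
  case Nil
  then show ?case by (intro exI[of _ "\<lambda>_. u"]) (auto simp: supp_rel_one)
next
  case (Cons A As)
  have "mat_prod_list (p ^ n) As \<in> carrier_mat (p ^ n) (p ^ n)"
    using Cons.prems(1) by (intro mat_prod_list_carrier) simp
  with Cons.prems obtain w where w: "(u, w) \<in> supp_rel p n A"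
    "(w, v) \<in> supp_rel p n (mat_prod_list (p ^ n) As)"
    by (auto simp: supp_rel_mult)
  from Cons.IH[OF _ w(2)] Cons.prems(1) obtain f where
    f: "f 0 = w" "f (length As) = v" "\<forall>i \<le> length As. f i \<in> words p n"
    "\<forall>i < length As. (f i, f (Suc i)) \<in> supp_rel p n (As ! i)" by auto
  have "u \<in> words p n" using w(1) by (simp add: supp_rel_def)
  then show ?case using f w(1)
    by (intro exI[of _ "case_nat u f"]) (auto split: nat.split simp: nth_Cons)
qed

text \<open>\<open>filled\<close> and the product recurse along the row in the same way: the
  summation index is the column \<open>w\<close>, and a row of one letter gives the empty product,
  whose unit matrix matches the case \<open>u = v\<close>.\<close>

lemma supp_rel_H_block_prod:
  assumes "x \<noteq> []" "set x \<subseteq> {..<p}"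
  shows "supp_rel p k (mat_prod_list (p ^ k)
    (map (\<lambda>c. H_block p \<B> (Suc k) (x ! c + 1) (x ! (c + 1) + 1)) [0..<length x - 1])) =
    strip_rel p \<B> {x} k"
  using assms
proof (induction x)
  case (Cons i x)
  show ?case
  proof (cases x)
    case Nil
    then show ?thesis by (auto simp: supp_rel_one strip_rel_def)
  next
    case (Cons j js)
    let ?F = "\<lambda>x c. H_block p \<B> (Suc k) (x ! c + 1) (x ! (c + 1) + 1)"
    have m: "map (?F (i # x)) [0..<length (i # x) - 1] =
        ?F (i # x) 0 # map (?F x) [0..<length x - 1]"
      using Cons by (simp add: map_upt_Suc del: upt_Suc)
    have c: "H_block p \<B> (Suc k) a b \<in> carrier_mat (p ^ k) (p ^ k)" for a b
      using H_block_carrier[of p \<B> "Suc k"] by simp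
    then have "mat_prod_list (p ^ k) (map (?F x) [0..<length x - 1]) \<in> carrier_mat (p ^ k) (p ^ k)"
      by (intro mat_prod_list_carrier) auto
    then have "supp_rel p k (mat_prod_list (p ^ k) (map (?F (i # x)) [0..<length (i # x) - 1])) =
        supp_rel p k (?F (i # x) 0) O strip_rel p \<B> {x} k"
      unfolding m using Cons.IH Cons.prems Cons c by (simp add: supp_rel_mult)
    also have "\<dots> = strip_rel p \<B> {i # x} k"
      using Cons Cons.prems by (auto simp: supp_rel_def strip_rel_def relcomp_unfold H_block_pos_iff)
    finally show ?thesis .
  qed
qed simp

lemma supp_rel_H_elem:
  assumes "m \<ge> 2" "a < p" "b < p" "l \<in> {1..p ^ (m - 1)}"
  shows "supp_rel p k (H_elem p \<B> m (Suc k) (psi p [a, b]) l) =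
    strip_rel p \<B> {a # word_of p (m - 1) l @ [b]} k"
proof -
  let ?w = "word_of p (m - 1) l"
  have w: "?w \<in> words p (m - 1)" by (rule word_of_mem[OF assms(4)])
  then have x: "set (a # ?w @ [b]) \<subseteq> {..<p}" "length (a # ?w @ [b]) - 1 = m"
    using assms by (auto simp: words_def)
  have "word_of p 2 (psi p [a, b]) = [a, b]" using assms by (intro word_of_psi) auto
  then show ?thesis
    using supp_rel_H_block_prod[OF _ x(1), of k \<B>] unfolding x(2) by (simp add: H_elem_def)
qed

text \<open>A sum of natural numbers is positive iff one term is; finiteness keeps the sum from
  being the default value 0.\<close>

lemma supp_rel_mat_sum:
  assumes "finite I"
  shows "supp_rel p n (mat_sum (p ^ n) F I) = (\<Union>x \<in> I. supp_rel p n (F x))"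
  using assms by (auto simp: supp_rel_def mat_sum_def idx_less sum_pos2 simp flip: neq0_conv)

lemma mat_sum_carrier: "mat_sum d F I \<in> carrier_mat d d"
  by (simp add: mat_sum_def)

section \<open>Stacking rows along the diagonal cycle\<close>

text \<open>A diagonal index encodes two equal end letters, as \<open>1 + j * (p + 1)\<close> is
  \<open>1 + j * p + j\<close>. Going round the cycle therefore adds the same letters to both outer
  columns.\<close>

lemma diag_indices_eq: "diag_indices p = (\<lambda>j. psi p [j, j]) ` {..<p}"
  by (auto simp: diag_indices_def psi_Cons image_iff algebra_simps)

text \<open>Factor \<open>i\<close> of the cycle product joins row \<open>i\<close> to row
  \<open>i + 1\<close>: the letters \<open>b\<close> are the ends and the intermediate words the
  interiors. Reduction mod \<open>q\<close> gives row \<open>q\<close> the ends \<open>b 0\<close>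
  again.\<close>

lemma row_chain_of_S_cycle_prod:
  assumes "m \<ge> 1" "q \<ge> 1" "length \<beta>s = q"
    and b: "\<And>i. i < q \<Longrightarrow> b i < p \<and> \<beta>s ! i = psi p [b i, b i]"
    and "(s, t) \<in> supp_rel p (m - 1) (S_cycle_prod p \<B> m \<beta>s)"
  shows "\<exists>x. x 0 = b 0 # s @ [b 0] \<and> x q = b 0 # t @ [b 0] \<and>
    (\<forall>i \<le> q. x i \<in> words p (m + 1) \<and> hd (x i) = b (i mod q) \<and> last (x i) = b (i mod q)) \<and>
    (\<forall>i < q. row_adj \<B> (x i) (x (Suc i)))"
proof -
  obtain f where f: "f 0 = s" "f q = t" "\<And>i. i \<le> q \<Longrightarrow> f i \<in> words p (m - 1)"
    and f_adj: "\<And>i. i < q \<Longrightarrow>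
      (f i, f (Suc i)) \<in> supp_rel p (m - 1) (S_mat p \<B> m (\<beta>s ! i) (\<beta>s ! (Suc i mod q)))"
    using supp_rel_mat_prod_listD[of
        "map (\<lambda>c. S_mat p \<B> m (\<beta>s ! c) (\<beta>s ! ((c + 1) mod length \<beta>s))) [0..<length \<beta>s]" p "m - 1" s t]
      assms(5) S_mat_carrier[of p \<B> m]
    unfolding S_cycle_prod_def assms(3) by auto
  define x where "x i = b (i mod q) # f i @ [b (i mod q)]" for i
  have bp: "b (i mod q) < p" for i using b[of "i mod q"] assms(2) by simp
  have "row_adj \<B> (x i) (x (Suc i))" if i: "i < q" for i
  proof -
    have "S_mat p \<B> m (psi p [b i, b i]) (psi p [b (Suc i mod q), b (Suc i mod q)]) $$
        (idx p (f i), idx p (f (Suc i))) > 0"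
      using f_adj[OF i] b[OF i] b[of "Suc i mod q"] assms(2) by (simp add: supp_rel_def)
    then have "row_adj \<B> (b i # f i @ [b i]) (b (Suc i mod q) # f (Suc i) @ [b (Suc i mod q)])"
      using S_mat_pos_iff[OF assms(1)] b[OF i] bp[of "Suc i"] f(3)[of i] f(3)[of "Suc i"] i by simp
    then show ?thesis using i by (simp add: x_def)
  qed
  moreover have "x i \<in> words p (m + 1)" if "i \<le> q" for i
    using words_append[OF f(3)[OF that], of "[b (i mod q)]" 1] bp[of i] assms(1) by (simp add: x_def)
  ultimately show ?thesis using f(1,2) by (intro exI[of _ x]) (simp add: x_def)
qed

text \<open>A strip over a row with interior \<open>t\<close> in \<open>W\<close> is raised by one
  turn of the cycle. Invariance runs downwards: it yields an \<open>s\<close> in \<open>W\<close>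
  from which the rows climb to \<open>t\<close>, so the new bottom row lies in \<open>X\<close>
  again.\<close>

lemma strip_rel_cycle_lift:
  assumes "m \<ge> 1" "q \<ge> 1" "length \<beta>s = q"
    and b: "\<And>i. i < q \<Longrightarrow> b i < p \<and> \<beta>s ! i = psi p [b i, b i]"
    and inv: "\<And>t. t \<in> W \<Longrightarrow> \<exists>s \<in> W. (s, t) \<in> supp_rel p (m - 1) (S_cycle_prod p \<B> m \<beta>s)"
    and X: "X = (\<lambda>w. b 0 # w @ [b 0]) ` W"
    and c: "c = map (\<lambda>i. b (Suc i mod q)) [0..<q]"
    and uv: "(u, v) \<in> strip_rel p \<B> X k"
  shows "(c @ u, c @ v) \<in> strip_rel p \<B> X (q + k)"
proof -
  from uv X obtain t where t: "t \<in> W" "filled p \<B> k (b 0 # t @ [b 0]) u v"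
    and w: "u \<in> words p k" "v \<in> words p k" by (auto simp: strip_rel_def)
  from inv[OF t(1)] obtain s where s: "s \<in> W" "(s, t) \<in> supp_rel p (m - 1) (S_cycle_prod p \<B> m \<beta>s)"
    by blast
  from row_chain_of_S_cycle_prod[OF assms(1-4) s(2)] obtain x where
    x0: "x 0 = b 0 # s @ [b 0]" and xq: "x q = b 0 # t @ [b 0]" and
    x: "\<And>i. i \<le> q \<Longrightarrow> x i \<in> words p (m + 1) \<and> hd (x i) = b (i mod q) \<and> last (x i) = b (i mod q)"
    and adj: "\<And>i. i < q \<Longrightarrow> row_adj \<B> (x i) (x (Suc i))" by blast
  \<comment> \<open>Columns omit the bottom row \<open>x 0\<close>, so the prefix \<open>c\<close>
    starts with the letter of row 1 and closes with \<open>b 0\<close>.\<close>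
  have cs: "map (\<lambda>i. hd (x (Suc i))) [0..<q] = c" "map (\<lambda>i. last (x (Suc i))) [0..<q] = c"
    using x unfolding c by (auto intro!: map_cong)
  have "filled p \<B> (q + k) (x 0) (map (\<lambda>i. hd (x (Suc i))) [0..<q] @ u)
           (map (\<lambda>i. last (x (Suc i))) [0..<q] @ v)"
  proof (rule filled_up_chain[where r = "m + 1"])
    show "filled p \<B> k (x q) u v" using t(2) xq by simp
    show "set (x i) \<subseteq> {..<p}" "length (x i) = m + 1" if "i \<le> q" for i
      using x[OF that] by (simp_all add: words_def)
  qed (fact adj)
  then have "filled p \<B> (q + k) (b 0 # s @ [b 0]) (c @ u) (c @ v)" unfolding cs x0 .
  moreover have "b (i mod q) < p" for i using b[of "i mod q"] assms(2) by simp
  then have "c \<in> words p q" unfolding c by (auto simp: words_def)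
  ultimately show ?thesis using s(1) w unfolding X strip_rel_def by (auto intro: words_append)
qed

section \<open>Primitivity of all \<open>H_n\<close>\<close>

theorem theorem4p4:
  fixes p m q :: nat and \<B> :: "pattern set" and \<beta>s :: "nat list" and K :: "nat set"
  assumes "p \<ge> 2"
    and "\<B> \<subseteq> patterns p (rect 2 2)"
    and "H2_non_degenerated p \<B>"
    and "S_invariant_diagonal_cycle p \<B> m q \<beta>s K"
    and "\<And>n. 2 \<le> n \<Longrightarrow> n \<le> q + 1 \<Longrightarrow>
           primitive_mat (mat_sum (p ^ (n - 1)) (\<lambda>l. H_elem p \<B> m n (\<beta>s ! 0) l) K)"
  shows "\<forall>n \<ge> 2. primitive_mat (H_mat p \<B> n)"
proof (intro allI impI)
  fix n :: nat assume n: "n \<ge> 2"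
  have m: "m \<ge> 2" and q: "q \<ge> 1" "length \<beta>s = q" and diag: "set \<beta>s \<subseteq> diag_indices p"
    and K: "K \<subseteq> {1..p ^ (m - 1)}"
    and inv: "\<And>l. l \<in> K \<Longrightarrow> (\<Sum>k \<in> K. S_cycle_prod p \<B> m \<beta>s $$ (k - 1, l - 1)) \<ge> 1"
    using assms(4) by (auto simp: S_invariant_diagonal_cycle_def diagonal_cycle_def)
  have "\<exists>j<p. \<beta>s ! i = psi p [j, j]" if "i < q" for i
    using subsetD[OF diag nth_mem[of i \<beta>s]] q(2) that by (auto simp: diag_indices_eq)
  then obtain b where b: "\<And>i. i < q \<Longrightarrow> b i < p \<and> \<beta>s ! i = psi p [b i, b i]" by metis
  \<comment> \<open>\<open>W\<close> holds the interiors numbered by \<open>K\<close>,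
    \<open>X\<close> the bottom rows of the elementary patterns summed in \<open>A_n\<close>, and
    \<open>c\<close> the letters gained by both outer columns in one turn of the cycle.\<close>
  define W where "W = word_of p (m - 1) ` K"
  define X where "X = (\<lambda>w. b 0 # w @ [b 0]) ` W"
  define c where "c = map (\<lambda>i. b (Suc i mod q)) [0..<q]"
  have b0: "b 0 < p" "\<beta>s ! 0 = psi p [b 0, b 0]" using b[of 0] q(1) by auto
  have W: "W \<subseteq> words p (m - 1)" using word_of_mem[OF subsetD[OF K]] unfolding W_def by blast
  then have X: "\<forall>x \<in> X. set x \<subseteq> {..<p} \<and> length x = Suc m \<and> hd x = b 0 \<and> last x = b 0"
    using b0(1) m by (auto simp: X_def words_def)
  have c: "c \<in> words p q" using b q(1) by (auto simp: c_def words_def)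
  have ext: "extendable p \<B>" by (rule extendable_if_non_degenerated[OF assms(3)])
  have W_inv: "\<exists>s \<in> W. (s, t) \<in> supp_rel p (m - 1) (S_cycle_prod p \<B> m \<beta>s)" if t: "t \<in> W" for t
  proof -
    from t obtain l where l: "l \<in> K" "t = word_of p (m - 1) l" by (auto simp: W_def)
    \<comment> \<open>Column \<open>l\<close> of the cycle product has a nonzero entry in some row
      \<open>k\<close> of \<open>K\<close>; this \<open>k\<close> numbers the interior
      \<open>s\<close> below \<open>t\<close>.\<close>
    have "(\<Sum>k \<in> K. S_cycle_prod p \<B> m \<beta>s $$ (k - 1, l - 1)) \<noteq> 0" using inv[OF l(1)] by linarith
    then obtain k where k: "k \<in> K" "S_cycle_prod p \<B> m \<beta>s $$ (k - 1, l - 1) \<noteq> 0"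
      by (rule sum.not_neutral_contains_not_neutral)
    note range = subsetD[OF K k(1)] subsetD[OF K l(1)]
    have "(word_of p (m - 1) k, t) \<in> supp_rel p (m - 1) (S_cycle_prod p \<B> m \<beta>s)"
      using range[THEN word_of_mem] k(2)
      unfolding l(2) supp_rel_def mem_Collect_eq case_prod_conv range[THEN idx_word_of] by blast
    then show ?thesis using k(1) by (auto simp: W_def)
  qed
  \<comment> \<open>Heights 1 to \<open>q\<close> above the bottom row are the cases
    \<open>n = 2\<close> to \<open>n = q + 1\<close> of the hypothesis.\<close>
  have small: "primitive_rel (words p k) (strip_rel p \<B> X k)" if k: "1 \<le> k" "k \<le> q" for k
  proof -
    let ?A = "mat_sum (p ^ k) (\<lambda>l. H_elem p \<B> m (Suc k) (\<beta>s ! 0) l) K"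
    have "supp_rel p k ?A = (\<Union>l \<in> K. strip_rel p \<B> {b 0 # word_of p (m - 1) l @ [b 0]} k)"
      unfolding supp_rel_mat_sum[OF finite_subset[OF K finite_atLeastAtMost]] b0(2)
      using supp_rel_H_elem[OF m b0(1) b0(1)] K by (intro SUP_cong refl) blast
    also have "\<dots> = strip_rel p \<B> X k" by (auto simp: strip_rel_def X_def W_def)
    finally have supp: "supp_rel p k ?A = strip_rel p \<B> X k" .
    have "primitive_mat ?A" using assms(5)[of "Suc k"] k by simp
    then show ?thesis unfolding primitive_mat_iff[OF mat_sum_carrier] supp .
  qed
  have lift: "(c @ u, c @ v) \<in> strip_rel p \<B> X (q + k)" if "(u, v) \<in> strip_rel p \<B> X k" for k u v
  proof (rule strip_rel_cycle_lift[where b = b and W = W and m = m and \<beta>s = \<beta>s])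
    show "m \<ge> 1" using m by simp
  qed (fact q b W_inv X_def c_def that)+
  have prim: "primitive_rel (words p (n - 1)) (strip_rel p \<B> X (n - 1))"
  proof (rule primitive_strip_rel_all[OF ext _ c q(1)])
    show "\<forall>x \<in> X. set x \<subseteq> {..<p}" using X by blast
    show "1 \<le> n - 1" using n by simp
  qed (fact lift small)+
  have "primitive_rel (words p (Suc (n - 1))) (col_rel p \<B> (Suc (n - 1)))"
    by (rule primitive_col_rel[OF ext b0(1) bspec[OF X] prim])
  then show "primitive_mat (H_mat p \<B> n)"
    using n by (simp add: primitive_mat_iff[OF H_mat_carrier] supp_rel_H_mat)
qed

end
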